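(* Let $\Sigma$ be a Y-network. Then any extended system $\hat\Sigma$ of $\Sigma$ composed of subsystems with homogeneous internal dynamics is not structurally output controllable.
   Context: **Original network.** $\Sigma$ is the structured system $\dot x=Ax+Bu$, $y=x$ (so the output matrix is $C=I_n$), with $x\in\mathbb{R}^n$, $u\in\mathbb{R}^m$. Each entry of $A\in\mathbb{R}^{n\times n}$ and $B\in\mathbb{R}^{n\times m}$ is either fixed to zero or a free (independent, arbitrary real) parameter, and all diagonal entries of $A$ are fixed to zero. The $i$-th component $x_i$ is the state of the $i$-th (first-order) subsystem; $a_{ij}$ ($i\neq j$) are the off-diagonal entries of $A$ and $b_{i,s}$ the entries of $B$. For entries of a structured matrix, "$\neq 0$" means "is a free parameter". **Extended system.** An extended system of $\Sigma$ is a structured system $\hat\Sigma$: $\dot{\hat x}=\hat A\hat x+\hat Bu$, $\hat y=\hat C\hat x$, with orders $\hat n_i\ge 1$ ($i=1,\dots,n$), $\hat n=\sum_i\hat n_i$, $\hat x=(\hat x_1,\dots,\hat x_n)$, $\hat x_i\in\mathbb{R}^{\hat n_i}$. The diagonal blocks of $\hat A$ are $\hat a_i\in\mathbb{R}^{\hat n_i\times\hat n_i}$ and the off-diagonal blocks are $\hat a_{ij}\in\mathbb{R}^{\hat n_i\times\hat n_j}$; $\hat B$ has block rows $\hat b_i\in\mathbb{R}^{\hat n_i\times m}$ with columns $\hat b_{i,s}$; $\hat C=\mathrm{diag}(\hat c_1,\dots,\hat c_n)\in\mathbb{R}^{n\times\hat n}$ with $\hat c_i\in\mathbb{R}^{1\times\hat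 n_i}$. Each entry of these matrices is free or fixed subject to the following. The entries of $\hat a_{ij}$ ($i\ne j$) may be free only if $a_{ij}\neq 0$, and are otherwise zero. The entries of $\hat b_{i,s}$ may be free only if $b_{i,s}\neq0$, and are otherwise zero. For each $i$, the entries of $\hat a_i$ are either all free (heterogeneous internal dynamics) or all fixed to zero (trivial internal dynamics). All entries of $\hat c_i$ are free if $\hat n_i>1$, and $\hat c_i=1$ if $\hat n_i=1$. The subsystems of $\hat\Sigma$ have homogeneous internal dynamics if $\hat a_i=0$ for all $i$ (the orders $\hat n_i\geq1$ being arbitrary). **Structural output controllability.** A structured system with state dimension $N$ and matrices $(A,B,C)$ is structurally output controllable if for some choice of the free parameters (including those of $C$) the matrix $C[B\ AB\ \cdots\ A^{N-1}B]$ has full row rank. **Graph.** $\mathrm G(\Sigma)$ is the directed graph whose nodes are the state nodes $x_1,\dots,x_n$ and the input nodes $u_1,\dots,u_m$, with an edge $(x_i,x_j)$ iff $A_{ji}\ne0$ and an edge $(u_i,x_j)$ iff $B_{ji}\neq0$. A stem is a sequence of distinct nodes $v_1,\dots,v_\ell$ with $(v_k,v_{k+1})$ an edge for all $k$, $v_1$ an input node and $v_\ell$ a state node. A cycle is a closed sequence $v_1,\dots,v_\ell=v_1$ with $(v_k,v_{k+1})$ an edge for all $k$ and $v_1,\dots,v_{\ell-1}$ distinct. A set of stems and cycles covers a set of nodes if each of these nodes lies on some member. $\Sigma$ is input-accessible if every state node is the end vertex of a stem. **Conditions on a set $\mathcal P$ of stems and cycles.** $\mathcal P$ contains: 1) a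 stem and a cycle sharing some node; 2) two (distinct) cycles sharing some node; 3) two stems sharing some node and originating from different input nodes; 4) two (distinct) stems originating from the same input node. **Y-network.** An input-accessible network $\Sigma$ is a Y-network if every set of stems and cycles covering the state nodes of $\mathrm G(\Sigma)$ satisfies condition 4), but never satisfies any of conditions 1), 2), 3). *)

theory Defs
  imports
    "Jordan_Normal_Form.DL_Rank"
    "Graph_Theory.Pair_Digraph"
    "Graph_Theory.Vertex_Walk"
begin

text \<open>Besides zeros and free parameters, the constant \<open>1\<close> occurs as a fixed entry of an output matrix.\<close>

datatype entry = Fixed real | Free

record structured_system =
  state_mat :: "entry mat"
  input_mat :: "entry mat"
  output_mat :: "entry mat"

definition zero_or_free :: "entry mat \<Rightarrow> bool" where
  "zero_or_free M \<longleftrightarrow> elements_mat M \<subseteq> {Fixed 0, Free}"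

definition all_free :: "entry mat \<Rightarrow> bool" where
  "all_free M \<longleftrightarrow> elements_mat M \<subseteq> {Free}"

definition all_fixed :: "real \<Rightarrow> entry mat \<Rightarrow> bool" where
  "all_fixed c M \<longleftrightarrow> elements_mat M \<subseteq> {Fixed c}"

definition realization :: "entry mat \<Rightarrow> real mat \<Rightarrow> bool" where
  "realization S M \<longleftrightarrow> M \<in> carrier_mat (dim_row S) (dim_col S) \<and>
     (\<forall>i<dim_row S. \<forall>j<dim_col S. \<forall>c. S $$ (i, j) = Fixed c \<longrightarrow> M $$ (i, j) = c)"

definition network :: "nat \<Rightarrow> nat \<Rightarrow> structured_system \<Rightarrow> bool" where
  "network n m S \<longleftrightarrow>
     state_mat S \<in> carrier_mat n n \<and> zero_or_free (state_mat S) \<and>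
     (\<forall>i<n. state_mat S $$ (i, i) = Fixed 0) \<and>
     input_mat S \<in> carrier_mat n m \<and> zero_or_free (input_mat S) \<and>
     output_mat S = map_mat Fixed (1\<^sub>m n)"

text \<open>The columns of \<open>[B AB \<dots> A\<^bsup>N-1\<^esup>B]\<close> are numbered so that column \<open>k * m + s\<close>, with \<open>s < m\<close>,
  is column \<open>s\<close> of \<open>A\<^bsup>k\<^esup>B\<close>.\<close>

definition controllability_mat :: "real mat \<Rightarrow> real mat \<Rightarrow> real mat" where
  "controllability_mat A B =
     mat (dim_row A) (dim_row A * dim_col B)
       (\<lambda>(r, c). ((A ^\<^sub>m (c div dim_col B)) * B) $$ (r, c mod dim_col B))"

definition full_row_rank :: "real mat \<Rightarrow> bool" where
  "full_row_rank M \<longleftrightarrow> vec_space.rank (dim_row M) M = dim_row M"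

definition structurally_output_controllable :: "structured_system \<Rightarrow> bool" where
  "structurally_output_controllable S \<longleftrightarrow>
     (\<exists>A B C. realization (state_mat S) A \<and> realization (input_mat S) B \<and>
        realization (output_mat S) C \<and> full_row_rank (C * controllability_mat A B))"

definition offset :: "(nat \<Rightarrow> nat) \<Rightarrow> nat \<Rightarrow> nat" where
  "offset ord i = (\<Sum>j<i. ord j)"

text \<open>Block \<open>(i, j)\<close> of a matrix partitioned into row blocks of heights \<open>ro 0, ro 1, \<dots>\<close> and
  column blocks of widths \<open>co 0, co 1, \<dots>\<close>.\<close>

definition block ::
    "(nat \<Rightarrow> nat) \<Rightarrow> (nat \<Rightarrow> nat) \<Rightarrow> 'a mat \<Rightarrow> nat \<Rightarrow> nat \<Rightarrow> 'a mat" where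
  "block ro co M i j =
     mat (ro i) (co j) (\<lambda>(k, l). M $$ (offset ro i + k, offset co j + l))"

abbreviation unit_blocks :: "nat \<Rightarrow> nat" where
  "unit_blocks \<equiv> (\<lambda>_. 1)"

definition extended_system ::
    "nat \<Rightarrow> nat \<Rightarrow> structured_system \<Rightarrow> (nat \<Rightarrow> nat) \<Rightarrow> structured_system \<Rightarrow> bool" where
  "extended_system n m S ord E \<longleftrightarrow>
     (\<forall>i<n. 1 \<le> ord i) \<and>
     state_mat E \<in> carrier_mat (offset ord n) (offset ord n) \<and>
     input_mat E \<in> carrier_mat (offset ord n) m \<and>
     output_mat E \<in> carrier_mat n (offset ord n) \<and>
     (\<forall>i<n. \<forall>j<n. i \<noteq> j \<longrightarrow>
        (if state_mat S $$ (i, j) = Free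
         then zero_or_free (block ord ord (state_mat E) i j)
         else all_fixed 0 (block ord ord (state_mat E) i j))) \<and>
     (\<forall>i<n. all_free (block ord ord (state_mat E) i i) \<or>
            all_fixed 0 (block ord ord (state_mat E) i i)) \<and>
     (\<forall>i<n. \<forall>s<m.
        (if input_mat S $$ (i, s) = Free
         then zero_or_free (block ord unit_blocks (input_mat E) i s)
         else all_fixed 0 (block ord unit_blocks (input_mat E) i s))) \<and>
     (\<forall>i<n. if ord i > 1
            then all_free (block unit_blocks ord (output_mat E) i i)
            else all_fixed 1 (block unit_blocks ord (output_mat E) i i)) \<and>
     (\<forall>i<n. \<forall>j<n. i \<noteq> j \<longrightarrow> all_fixed 0 (block unit_blocks ord (output_mat E) i j))"

definition homogeneous_internal_dynamics ::
    "nat \<Rightarrow> (nat \<Rightarrow> nat) \<Rightarrow> structured_system \<Rightarrow> bool" where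
  "homogeneous_internal_dynamics n ord E \<longleftrightarrow>
     (\<forall>i<n. all_fixed 0 (block ord ord (state_mat E) i i))"

datatype node = State nat | Input nat

definition state_nodes :: "structured_system \<Rightarrow> node set" where
  "state_nodes S = State ` {..<dim_row (state_mat S)}"

definition input_nodes :: "structured_system \<Rightarrow> node set" where
  "input_nodes S = Input ` {..<dim_col (input_mat S)}"

definition system_graph :: "structured_system \<Rightarrow> node pair_pre_digraph" where
  "system_graph S =
     \<lparr> pverts = state_nodes S \<union> input_nodes S,
       parcs =
         {(State i, State j) | i j. i < dim_row (state_mat S) \<and> j < dim_row (state_mat S) \<and>
            state_mat S $$ (j, i) \<noteq> Fixed 0} \<union>
         {(Input i, State j) | i j. i < dim_col (input_mat S) \<and> j < dim_row (state_mat S) \<and>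
            input_mat S $$ (j, i) \<noteq> Fixed 0} \<rparr>"

definition stem :: "structured_system \<Rightarrow> node list \<Rightarrow> bool" where
  "stem S p \<longleftrightarrow> vpath p (system_graph S) \<and> hd p \<in> input_nodes S \<and> last p \<in> state_nodes S"

text \<open>The first node of a cycle is listed again as the last one.\<close>

definition cycle :: "structured_system \<Rightarrow> node list \<Rightarrow> bool" where
  "cycle S c \<longleftrightarrow>
     vwalk c (system_graph S) \<and> 2 \<le> length c \<and> hd c = last c \<and> distinct (butlast c)"

text \<open>Listing a cycle from another starting node does not give a different cycle.\<close>

definition same_cycle :: "node list \<Rightarrow> node list \<Rightarrow> bool" where
  "same_cycle c d \<longleftrightarrow> (\<exists>k. butlast d = rotate k (butlast c))"

definition input_accessible :: "structured_system \<Rightarrow> bool" where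
  "input_accessible S \<longleftrightarrow> (\<forall>v \<in> state_nodes S. \<exists>p. stem S p \<and> last p = v)"

definition stem_cycle_cover :: "structured_system \<Rightarrow> node list set \<Rightarrow> bool" where
  "stem_cycle_cover S P \<longleftrightarrow>
     (\<forall>p \<in> P. stem S p \<or> cycle S p) \<and> state_nodes S \<subseteq> (\<Union>p \<in> P. set p)"

definition stem_meets_cycle :: "structured_system \<Rightarrow> node list set \<Rightarrow> bool" where
  "stem_meets_cycle S P \<longleftrightarrow>
     (\<exists>p \<in> P. \<exists>c \<in> P. stem S p \<and> cycle S c \<and> set p \<inter> set c \<noteq> {})"

definition cycle_meets_cycle :: "structured_system \<Rightarrow> node list set \<Rightarrow> bool" where
  "cycle_meets_cycle S P \<longleftrightarrow>
     (\<exists>c \<in> P. \<exists>d \<in> P. cycle S c \<and> cycle S d \<and> \<not> same_cycle c d \<and> set c \<inter> set d \<noteq> {})"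

definition stems_of_different_inputs_meet :: "structured_system \<Rightarrow> node list set \<Rightarrow> bool" where
  "stems_of_different_inputs_meet S P \<longleftrightarrow>
     (\<exists>p \<in> P. \<exists>q \<in> P. stem S p \<and> stem S q \<and> hd p \<noteq> hd q \<and> set p \<inter> set q \<noteq> {})"

definition distinct_stems_of_one_input :: "structured_system \<Rightarrow> node list set \<Rightarrow> bool" where
  "distinct_stems_of_one_input S P \<longleftrightarrow>
     (\<exists>p \<in> P. \<exists>q \<in> P. stem S p \<and> stem S q \<and> p \<noteq> q \<and> hd p = hd q)"

definition Y_network :: "nat \<Rightarrow> nat \<Rightarrow> structured_system \<Rightarrow> bool" where
  "Y_network n m S \<longleftrightarrow> network n m S \<and> input_accessible S \<and>
     (\<forall>P. stem_cycle_cover S P \<longrightarrow>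
        distinct_stems_of_one_input S P \<and> \<not> stem_meets_cycle S P \<and>
        \<not> cycle_meets_cycle S P \<and> \<not> stems_of_different_inputs_meet S P)"

end

theory Submission
  imports Defs
begin

text \<open>Applied to the set of all stems and cycles, the Y-network conditions say that stems avoid
  cycles and that stems of different inputs are disjoint. Under homogeneous internal dynamics, a
  nonzero entry of \<open>A\<^bsup>k\<^esup>B\<close> of the extended system in column \<open>s\<close> gives a walk in the original graph
  from input \<open>s\<close> through \<open>k + 1\<close> states, and this walk is a stem because a repeated node would
  close a cycle meeting a stem. So input \<open>s\<close> yields at most as many nonzero columns of the output
  controllability matrix as there are states on a longest stem from \<open>s\<close>. One longest stem per
  input gives pairwise disjoint stems, which cannot cover all \<open>n\<close> states since condition 4 fails
  for them. Hence the matrix has fewer than \<open>n\<close> nonzero columns, and its rank is less than \<open>n\<close>.\<close>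

section \<open>Rank and nonzero columns\<close>

lemma rank_le_card_nonzero_cols:
  fixes M :: "'a::field mat"
  shows "vec_space.rank (dim_row M) M \<le> card {j. j < dim_col M \<and> col M j \<noteq> 0\<^sub>v (dim_row M)}"
    (is "_ \<le> card ?J")
proof -
  interpret vec_space "TYPE('a)" "dim_row M" .
  have "lin_indpt {}"
    by (rule finite_lin_indpt2) auto
  \<comment> \<open>The rank is the size of a maximal independent set \<open>U\<close> of columns.
    Such a set omits the zero vector, so each of its members is the column at some index in
    \<open>?J\<close>.\<close>
  then obtain U where U: "maximal U (\<lambda>T. T \<subseteq> set (cols M) \<and> lin_indpt T)"
    using maximal_exists_superset[of "set (cols M)" "\<lambda>T. T \<subseteq> set (cols M) \<and> lin_indpt T" "{}"]
    by auto
  then have sub: "U \<subseteq> set (cols M)" and li: "lin_indpt U"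
    by (auto simp: maximal_def)
  have "U \<subseteq> carrier_vec (dim_row M)"
    using sub cols_dim by blast
  moreover have "(UNIV :: 'a set) \<noteq> {0}"
    by (auto simp: set_eq_iff intro: exI[of _ 1])
  ultimately have "0\<^sub>v (dim_row M) \<notin> U"
    using zero_nin_lin_indpt[of U] li by (simp add: class_field_def)
  have "U \<subseteq> col M ` ?J"
  proof
    fix v assume "v \<in> U"
    with sub obtain j where "j < dim_col M" "v = col M j"
      by (auto simp: cols_def)
    with \<open>v \<in> U\<close> \<open>0\<^sub>v (dim_row M) \<notin> U\<close> show "v \<in> col M ` ?J"
      by auto
  qed
  then have "card U \<le> card ?J"
    by (intro surj_card_le) auto
  then show ?thesis
    unfolding rank_card_indpt[OF carrier_matI[OF refl refl] U] .
qed

section \<open>From entries of the extended system to arcs of the original graph\<close>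

lemma offset_decompose:
  assumes "r < offset ord n"
  obtains i k where "i < n" "k < ord i" "r = offset ord i + k"
proof -
  have "\<exists>i k. i < n \<and> k < ord i \<and> r = offset ord i + k"
    using assms
  proof (induction n)
    case 0
    then show ?case by (simp add: offset_def)
  next
    case (Suc n)
    show ?case
    proof (cases "r < offset ord n")
      case True
      with Suc.IH show ?thesis using less_Suc_eq by blast
    next
      case False
      with Suc.prems show ?thesis
        by (intro exI[of _ n] exI[of _ "r - offset ord n"]) (auto simp: offset_def)
    qed
  qed
  with that show thesis by blast
qed

lemma block_in_elements_mat:
  assumes "k < ro i" "l < co j"
  shows "M $$ (offset ro i + k, offset co j + l) \<in> elements_mat (block ro co M i j)"
  using assms unfolding block_def by (intro elements_matI[of _ "ro i" "co j" k l]) auto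

text \<open>This is where homogeneity enters: it makes the diagonal blocks zero, so a nonzero entry
  lies in an off-diagonal block, and such a block may be nonzero only over a free parameter of
  \<open>S\<close>.\<close>

lemma extended_state_edge:
  assumes ext: "extended_system n m S ord E" and hom: "homogeneous_internal_dynamics n ord E"
    and re: "realization (state_mat E) A"
    and i: "i < n" "k < ord i" and j: "j < n" "l < ord j"
    and nz: "A $$ (offset ord i + k, offset ord j + l) \<noteq> 0"
  shows "state_mat S $$ (i, j) = Free"
proof (rule ccontr)
  assume nf: "state_mat S $$ (i, j) \<noteq> Free"
  have bound: "offset ord i + k < offset ord n" if "i < n" "k < ord i" for i k
  proof -
    have "offset ord i + k < offset ord (Suc i)"
      using that by (simp add: offset_def)
    also have "\<dots> \<le> offset ord n"
      unfolding offset_def using that by (intro sum_mono2) auto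
    finally show ?thesis .
  qed
  have "all_fixed 0 (block ord ord (state_mat E) i j)"
    using ext hom i j nf
    by (cases "i = j") (auto simp: extended_system_def homogeneous_internal_dynamics_def)
  then have "state_mat E $$ (offset ord i + k, offset ord j + l) = Fixed 0"
    using block_in_elements_mat[of k ord i l ord j "state_mat E"] i j by (auto simp: all_fixed_def)
  moreover have "state_mat E \<in> carrier_mat (offset ord n) (offset ord n)"
    using ext by (simp add: extended_system_def)
  ultimately show False
    using re nz bound[OF i] bound[OF j] by (auto simp: realization_def)
qed

lemma extended_input_edge:
  assumes ext: "extended_system n m S ord E"
    and re: "realization (input_mat E) B"
    and i: "i < n" "k < ord i" "offset ord i + k < offset ord n" and s: "s < m"
    and nz: "B $$ (offset ord i + k, s) \<noteq> 0"
  shows "input_mat S $$ (i, s) = Free"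
proof (rule ccontr)
  assume nf: "input_mat S $$ (i, s) \<noteq> Free"
  have "all_fixed 0 (block ord unit_blocks (input_mat E) i s)"
    using ext i s nf by (auto simp: extended_system_def simp del: One_nat_def)
  \<comment> \<open>Column blocks of \<open>input_mat E\<close> have width 1, so the inner column
    index is \<open>0\<close> and \<open>offset unit_blocks s = s\<close>.\<close>
  then have "input_mat E $$ (offset ord i + k, s) = Fixed 0"
    using block_in_elements_mat[of k ord i 0 unit_blocks s "input_mat E"] i
    by (auto simp: all_fixed_def offset_def)
  moreover have "input_mat E \<in> carrier_mat (offset ord n) m"
    using ext by (simp add: extended_system_def)
  ultimately show False
    using re nz i s by (auto simp: realization_def)
qed

section \<open>Walks, stems and cycles in a Y-network\<close>

lemma vwalk_snoc:
  assumes "vwalk p G" "(last p, v) \<in> arcs_ends G" "v \<in> verts G"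
  shows "vwalk (p @ [v]) G"
  using assms by (auto simp: vwalk_def set_vwalk_arcs_snoc)

text \<open>The part of \<open>p\<close> from \<open>v\<close> on is closed to a cycle by the arc
  back to \<open>v\<close>; if \<open>v\<close> is the last node, the cycle is the loop
  \<open>[v, v]\<close>.\<close>

lemma cycle_of_repeated_node:
  assumes "vwalk p (system_graph S)" "distinct p" "v \<in> set p"
    and arc: "(last p, v) \<in> parcs (system_graph S)"
  obtains c where "cycle S c" "v \<in> set c"
proof -
  obtain a b where p: "p = a @ v # b"
    using \<open>v \<in> set p\<close> by (meson split_list)
  have "vwalk (v # b) (system_graph S)"
    using assms(1) p vwalkI_append_r by blast
  then have "vwalk ((v # b) @ [v]) (system_graph S)"
    using arc p by (intro vwalk_snoc) (auto simp: vwalk_def)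
  then have "cycle S (v # b @ [v])"
    using assms(2) p by (auto simp: cycle_def butlast_append)
  then show thesis
    using that by auto
qed

text \<open>Input accessibility makes the largest possible family a cover. What a Y-network forbids
  in a cover is thereby forbidden for any two stems or cycles of the graph.\<close>

lemma stem_cycle_cover_all:
  assumes "input_accessible S"
  shows "stem_cycle_cover S {p. stem S p \<or> cycle S p}"
  unfolding stem_cycle_cover_def
proof (intro conjI subsetI)
  fix v assume "v \<in> state_nodes S"
  then obtain p where "stem S p" "last p = v"
    using assms unfolding input_accessible_def by blast
  moreover from this have "v \<in> set p"
    by (auto simp: stem_def vpath_def vwalk_def)
  ultimately show "v \<in> (\<Union>p \<in> {p. stem S p \<or> cycle S p}. set p)"
    by blast
qed auto

lemma Y_network_stem_avoids_cycle:
  assumes "Y_network n m S" "stem S p" "cycle S c"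
  shows "set p \<inter> set c = {}"
  using assms stem_cycle_cover_all[of S] unfolding Y_network_def stem_meets_cycle_def by blast

lemma Y_network_stems_disjoint:
  assumes "Y_network n m S" "stem S p" "stem S q" "hd p \<noteq> hd q"
  shows "set p \<inter> set q = {}"
  using assms stem_cycle_cover_all[of S]
  unfolding Y_network_def stems_of_different_inputs_meet_def by blast

lemma Y_network_stem_snoc:
  assumes Y: "Y_network n m S" and p: "stem S p"
    and arc: "(last p, State i) \<in> parcs (system_graph S)" and i: "i < dim_row (state_mat S)"
  shows "stem S (p @ [State i])"
proof -
  have walk: "vwalk p (system_graph S)" and dist: "distinct p"
    using p by (auto simp: stem_def vpath_def)
  have "State i \<notin> set p"
    using cycle_of_repeated_node[OF walk dist _ arc] Y_network_stem_avoids_cycle[OF Y p] by blast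
  moreover have "vwalk (p @ [State i]) (system_graph S)"
    using walk arc i by (intro vwalk_snoc) (auto simp: system_graph_def state_nodes_def)
  ultimately show ?thesis
    using p dist i walk by (auto simp: stem_def vpath_def state_nodes_def vwalk_def)
qed

section \<open>Nonzero entries of powers and stems\<close>

lemma pow_mat_mult_Suc:
  fixes A :: "'a::semiring_1 mat"
  assumes "A \<in> carrier_mat n n" "B \<in> carrier_mat n m"
  shows "A ^\<^sub>m Suc k * B = A * (A ^\<^sub>m k * B)"
proof -
  \<comment> \<open>\<open>A ^\<^sub>m Suc k\<close> has its new factor on the right. Moving it to
    the left exposes the last arc of a walk, the one that extends a stem at its end.\<close>
  have "A ^\<^sub>m k * A = A * A ^\<^sub>m k"
  proof (induction k)
    case 0
    then show ?case using assms by simp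
  next
    case (Suc k)
    have "A ^\<^sub>m Suc k * A = (A * A ^\<^sub>m k) * A"
      using Suc by simp
    also have "\<dots> = A * (A ^\<^sub>m k * A)"
      using assms by (intro assoc_mult_mat[of _ n n _ n _ n]) auto
    finally show ?case by simp
  qed
  then show ?thesis
    using assms by (simp add: assoc_mult_mat[of A n n "A ^\<^sub>m k" n B m])
qed

lemma mult_mat_nonzero_entry:
  fixes A B :: "'a::semiring_0 mat"
  assumes "A \<in> carrier_mat n l" "B \<in> carrier_mat l m" "i < n" "j < m" "(A * B) $$ (i, j) \<noteq> 0"
  obtains q where "q < l" "A $$ (i, q) \<noteq> 0" "B $$ (q, j) \<noteq> 0"
proof -
  have "(\<Sum>q<l. A $$ (i, q) * B $$ (q, j)) \<noteq> 0"
    using assms by (simp add: scalar_prod_def lessThan_atLeast0)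
  then obtain q where "q < l" "A $$ (i, q) * B $$ (q, j) \<noteq> 0"
    by (metis (no_types, lifting) lessThan_iff sum.neutral)
  with that show thesis by force
qed

text \<open>The entry is a sum of products along walks from input \<open>s\<close>, and the
  induction follows one nonzero product. The exact length, one input and \<open>k + 1\<close>
  states, lets a longest stem bound the exponent \<open>k\<close>.\<close>

lemma stem_of_nonzero_entry:
  assumes Y: "Y_network n m S" and ext: "extended_system n m S ord E"
    and hom: "homogeneous_internal_dynamics n ord E"
    and A: "realization (state_mat E) A" and B: "realization (input_mat E) B"
    and "i < n" "l < ord i" "offset ord i + l < offset ord n" and s: "s < m"
    and "(A ^\<^sub>m k * B) $$ (offset ord i + l, s) \<noteq> 0"
  shows "\<exists>p. stem S p \<and> hd p = Input s \<and> last p = State i \<and> length p = k + 2"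
  using assms(6-8,10)
proof (induction k arbitrary: i l)
  case dims: 0
  have net: "network n m S"
    using Y by (simp add: Y_network_def)
  have Bc: "A \<in> carrier_mat (offset ord n) (offset ord n)" "B \<in> carrier_mat (offset ord n) m"
    using A B ext by (auto simp: realization_def extended_system_def)
  have "input_mat S $$ (i, s) = Free"
    using dims Bc by (intro extended_input_edge[OF ext B _ _ _ s, of i l]) auto
  then have "stem S [Input s, State i]"
    using net dims(1) s
    by (auto simp: stem_def vpath_def vwalk_def system_graph_def state_nodes_def input_nodes_def
        network_def)
  then show ?case by force
next
  case (Suc k)
  have net: "network n m S"
    using Y by (simp add: Y_network_def)
  have Ac: "A \<in> carrier_mat (offset ord n) (offset ord n)" and Bc: "B \<in> carrier_mat (offset ord n) m"
    using A B ext by (auto simp: realization_def extended_system_def)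
  have "(A * (A ^\<^sub>m k * B)) $$ (offset ord i + l, s) \<noteq> 0"
    using Suc.prems(4) pow_mat_mult_Suc[OF Ac Bc] by simp
  then obtain q where q: "q < offset ord n" "A $$ (offset ord i + l, q) \<noteq> 0"
      "(A ^\<^sub>m k * B) $$ (q, s) \<noteq> 0"
    using mult_mat_nonzero_entry[of A "offset ord n" "offset ord n" "A ^\<^sub>m k * B" m] Suc.prems Ac Bc s
    by (metis mult_carrier_mat pow_carrier_mat)
  \<comment> \<open>Only the block \<open>j\<close> containing \<open>q\<close> matters: it is the
    predecessor state in the original graph.\<close>
  from q(1) obtain j l' where j: "j < n" "l' < ord j" "q = offset ord j + l'"
    by (rule offset_decompose)
  with q Suc.IH obtain p where p: "stem S p" "hd p = Input s" "last p = State j" "length p = k + 2"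
    by blast
  have "state_mat S $$ (i, j) = Free"
    using extended_state_edge[OF ext hom A] Suc.prems j q(2) by blast
  then have "(last p, State i) \<in> parcs (system_graph S)"
    using net p(3) j Suc.prems by (auto simp: system_graph_def network_def)
  then have "stem S (p @ [State i])"
    using Suc.prems net by (intro Y_network_stem_snoc[OF Y p(1)]) (auto simp: network_def)
  moreover have "hd (p @ [State i]) = Input s" "length (p @ [State i]) = Suc k + 2"
    using p by (auto simp: hd_append)
  ultimately show ?case by (metis last_snoc)
qed

section \<open>Counting states on stems and nonzero columns\<close>

lemma stem_tail_states:
  assumes "stem S p"
  shows "set (tl p) \<subseteq> state_nodes S" "card (set (tl p)) = length p - 1"
proof -
  \<comment> \<open>Every arc ends in a state, so at most the first node of a walk is an
    input.\<close>
  have "set (tl p) \<subseteq> state_nodes S" if "set (vwalk_arcs p) \<subseteq> parcs (system_graph S)"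
    using that
    by (induction p rule: vwalk_arcs.induct) (auto simp: system_graph_def state_nodes_def)
  then show "set (tl p) \<subseteq> state_nodes S"
    using assms by (auto simp: stem_def vpath_def vwalk_def)
  show "card (set (tl p)) = length p - 1"
    using assms by (simp add: stem_def vpath_def distinct_card distinct_tl)
qed

lemma finite_state_nodes: "finite (state_nodes S)"
  and card_state_nodes: "card (state_nodes S) = dim_row (state_mat S)"
  by (simp_all add: state_nodes_def card_image inj_on_def)

lemma Y_network_disjoint_stems_miss_state:
  assumes Y: "Y_network n m S" and "finite T"
    and p: "\<And>s. s \<in> T \<Longrightarrow> stem S (p s) \<and> hd (p s) = Input s"
  shows "(\<Sum>s\<in>T. length (p s) - 1) < n"
proof -
  let ?U = "\<Union>s\<in>T. set (tl (p s))"
  have n: "card (state_nodes S) = n"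
    using Y by (auto simp: Y_network_def network_def card_state_nodes)
  have sub: "?U \<subseteq> state_nodes S"
    using p stem_tail_states by blast
  have tl_sub: "set (tl (p s)) \<subseteq> set (p s)" for s
    by (cases "p s") auto
  have "set (tl (p s)) \<inter> set (tl (p t)) = {}" if "s \<in> T" "t \<in> T" "s \<noteq> t" for s t
  proof -
    have "set (p s) \<inter> set (p t) = {}"
      using p that by (intro Y_network_stems_disjoint[OF Y]) auto
    then show ?thesis
      using tl_sub by blast
  qed
  then have "card ?U = (\<Sum>s\<in>T. card (set (tl (p s))))"
    using \<open>finite T\<close> by (intro card_UN_disjoint) auto
  then have card: "card ?U = (\<Sum>s\<in>T. length (p s) - 1)"
    using p stem_tail_states(2) by (metis (no_types, lifting) sum.cong)
  \<comment> \<open>Two stems of the family with the same first node have the same index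
    \<open>s\<close>, hence coincide.\<close>
  have "\<not> distinct_stems_of_one_input S (p ` T)"
    using p by (auto simp: distinct_stems_of_one_input_def)
  then have "\<not> stem_cycle_cover S (p ` T)"
    using Y by (auto simp: Y_network_def)
  then have "\<not> state_nodes S \<subseteq> (\<Union>s\<in>T. set (p s))"
    using p by (auto simp: stem_cycle_cover_def)
  then have "?U \<noteq> state_nodes S"
    using tl_sub by blast
  with sub have "card ?U < card (state_nodes S)"
    by (intro psubset_card_mono finite_state_nodes) blast
  with card n show ?thesis by simp
qed

lemma Y_network_longest_stems:
  assumes Y: "Y_network n m S"
    and "finite K" and K: "\<And>k s. (k, s) \<in> K \<Longrightarrow> \<exists>q. stem S q \<and> hd q = Input s \<and> length q = k + 2"
  shows "card K < n"
proof -
  define p where "p s = arg_max length (\<lambda>q. stem S q \<and> hd q = Input s)" for s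
  have longest: "(stem S (p s) \<and> hd (p s) = Input s) \<and> k + 2 \<le> length (p s)" if ks: "(k, s) \<in> K" for k s
  proof -
    obtain q where q: "stem S q \<and> hd q = Input s" "length q = k + 2"
      using K[OF ks] by blast
    \<comment> \<open>The maximum is attained because lengths are bounded: a stem has one input and
      at most \<open>n\<close> states, so \<open>n + 2\<close> is a strict bound.\<close>
    have "\<forall>q. stem S q \<and> hd q = Input s \<longrightarrow> length q \<le> n + 1"
    proof (intro allI impI)
      fix q assume "stem S q \<and> hd q = Input s"
      then have "length q - 1 \<le> card (state_nodes S)"
        using stem_tail_states by (metis card_mono finite_state_nodes)
      also have "\<dots> = n"
        using Y by (auto simp: Y_network_def network_def card_state_nodes)
      finally show "length q \<le> n + 1" by simp
    qed
    then have "stem S (p s) \<and> hd (p s) = Input s" "length q \<le> length (p s)"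
      unfolding p_def
      using arg_max_nat_lemma[of "\<lambda>q. stem S q \<and> hd q = Input s" q length "n + 2"] q(1) by force+
    with q(2) show ?thesis by simp
  qed
  \<comment> \<open>From \<open>k + 2 \<le> length (p s)\<close> follows
    \<open>k < length (p s) - 1\<close>. The pairs are swapped so that the range of \<open>k\<close>
    may depend on \<open>s\<close>.\<close>
  have "K \<subseteq> (\<lambda>(s, k). (k, s)) ` (SIGMA s:snd ` K. {..<length (p s) - 1})"
  proof
    fix x assume "x \<in> K"
    then show "x \<in> (\<lambda>(s, k). (k, s)) ` (SIGMA s:snd ` K. {..<length (p s) - 1})"
      using longest by (cases x) (force simp: image_iff)
  qed
  then have "card K \<le> card (SIGMA s:snd ` K. {..<length (p s) - 1})"
    using \<open>finite K\<close> by (intro surj_card_le) auto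
  also have "\<dots> = (\<Sum>s\<in>snd ` K. length (p s) - 1)"
    using \<open>finite K\<close> by simp
  also have "\<dots> < n"
    using longest \<open>finite K\<close> by (intro Y_network_disjoint_stems_miss_state[OF Y]) auto
  finally show ?thesis .
qed

theorem proposition2:
  fixes n m :: nat and S E :: structured_system and ord :: "nat \<Rightarrow> nat"
  assumes "Y_network n m S"
    and "extended_system n m S ord E"
    and "homogeneous_internal_dynamics n ord E"
  shows "\<not> structurally_output_controllable E"
proof
  assume "structurally_output_controllable E"
  then obtain A B C where A: "realization (state_mat E) A" and B: "realization (input_mat E) B"
      and C: "realization (output_mat E) C" and full: "full_row_rank (C * controllability_mat A B)"
    unfolding structurally_output_controllable_def by blast
  let ?N = "offset ord n" and ?M = "C * controllability_mat A B"
  have car: "A \<in> carrier_mat ?N ?N" "B \<in> carrier_mat ?N m" "C \<in> carrier_mat n ?N"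
    using A B C assms(2) by (auto simp: realization_def extended_system_def)
  have ctr: "controllability_mat A B \<in> carrier_mat ?N (?N * m)"
    using car by (simp add: controllability_mat_def)
  define J where "J = {c. c < dim_col ?M \<and> col ?M c \<noteq> 0\<^sub>v (dim_row ?M)}"
  \<comment> \<open>The column index \<open>c\<close> is split into the exponent
    \<open>c div m\<close> and the input \<open>c mod m\<close>.\<close>
  define K where "K = (\<lambda>c. (c div m, c mod m)) ` J"
  have "finite J"
    by (simp add: J_def)
  have "\<exists>q. stem S q \<and> hd q = Input s \<and> length q = k + 2" if "(k, s) \<in> K" for k s
  proof -
    obtain c where c: "c < ?N * m" "col ?M c \<noteq> 0\<^sub>v n" "k = c div m" "s = c mod m"
      using \<open>(k, s) \<in> K\<close> car ctr by (auto simp: K_def J_def)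
    \<comment> \<open>For \<open>m = 0\<close> there is no column \<open>c\<close> at all.\<close>
    have s: "s < m"
      using c by (cases "m = 0") auto
    obtain r where "r < n" "?M $$ (r, c) \<noteq> 0"
      using c(1,2) car ctr by (metis (no_types, lifting) carrier_matD dim_col eq_vecI index_col
          index_mult_mat(2,3) index_zero_vec)
    \<comment> \<open>Whatever the values in \<open>C\<close>, a nonzero column of the product needs
      a nonzero entry in the same column of the controllability matrix.\<close>
    then obtain q where q: "q < ?N" "controllability_mat A B $$ (q, c) \<noteq> 0"
      using mult_mat_nonzero_entry[OF car(3) ctr _ c(1)] by metis
    then have "(A ^\<^sub>m k * B) $$ (q, s) \<noteq> 0"
      using car c by (simp add: controllability_mat_def)
    moreover obtain i l where "i < n" "l < ord i" "q = offset ord i + l"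
      using q(1) by (rule offset_decompose)
    ultimately show ?thesis
      using stem_of_nonzero_entry[OF assms A B _ _ _ s] q(1) by blast
  qed
  then have "card K < n"
    using \<open>finite J\<close> by (intro Y_network_longest_stems[OF assms(1)]) (auto simp: K_def)
  \<comment> \<open>Quotient and remainder determine \<open>c\<close>, even for
    \<open>m = 0\<close>, where \<open>c mod 0 = c\<close>.\<close>
  moreover have "inj (\<lambda>c. (c div m, c mod m))"
    by (rule injI) (metis div_mult_mod_eq prod.inject)
  then have "card K = card J"
    unfolding K_def by (metis card_image inj_on_subset subset_UNIV)
  moreover have "n \<le> card J"
    using full rank_le_card_nonzero_cols[of ?M] car by (simp add: full_row_rank_def J_def)
  ultimately show False by simp
qed

end
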